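(* Let $G$ be a connected Lie group acting freely and properly on the left on a smooth manifold $M$, with principal bundle $\pi_M:M\to M/G$, and let a principal $k$-connection on $\pi_M$ with $\mathfrak g^k$-valued connection form $\vartheta^k:T^1_kM\to\mathfrak g^k$ be given. Let $\mathbf X$ be an integrable and $G$-invariant $k$-vector field on $M$ with integrable reduced $k$-vector field $\breve{\mathbf X}$ on $M/G$, and assume that the horizontal lift $\breve{\mathbf X}^H$ is integrable. Let $\breve\phi$ be an integral section of $\breve{\mathbf X}$ and $\breve\phi_H:\mathbb R^k\to M$ a horizontal lift of $\breve\phi$. If $g:\mathbb R^k\to G$ is a solution of the reconstruction equation $$g^{-1}g^{(1)}=\vartheta^k(\mathbf X\circ\breve\phi_H),$$ then $\phi:\mathbb R^k\to M$ defined by $\phi(t)=g(t)\breve\phi_H(t)$ is an integral section of $\mathbf X$.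
   Context: Everything is smooth. For a manifold $N$, $T^1_kN=TN\oplus\cdots\oplus TN$ ($k$ copies). A $k$-vector field on $N$ is a section of $T^1_kN$, i.e. a $k$-tuple $\mathbf X=(X_\alpha)$ of vector fields. The first prolongation of $\psi:\mathbb R^k\to N$ is $\psi^{(1)}(t)=(T_t\psi(\partial/\partial t^1|_t),\dots,T_t\psi(\partial/\partial t^k|_t))\in T^1_kN$; $\psi$ is an integral section of $\mathbf X$ if $\psi^{(1)}=\mathbf X\circ\psi$. $\mathbf X$ is integrable if through each point passes an integral section (defined on a neighbourhood of $0\in\mathbb R^k$). $\mathbf X$ on $M$ is $G$-invariant if each $X_\alpha$ is; its reduction $\breve{\mathbf X}$ is defined by $T\pi_M\circ X_\alpha=\breve X_\alpha\circ\pi_M$. A $k$-connection on $\pi_M$ is a linear bundle map $\gamma^k:M\times_{M/G}T^1_k(M/G)\to T^1_kM$ (over $M$) which is a right inverse of $T^1_kM\to M\times_{M/G}T^1_k(M/G)$, $(v_1,\dots,v_k)\mapsto(m,T\pi_M(v_1),\dots,T\pi_M(v_k))$. It determines the vertical projection $\omega^k:T^1_kM\to (VM)^k$, $VM=\ker T\pi_M$, and a form $\vartheta^k:T^1_kM\to\mathfrak g^k$ by $\omega^k(\mathbf v_m)=(\vartheta^k(\mathbf v_m))_M(m)$, where $(\xi_1,\dots,\xi_k)_M=((\xi_1)_M,\dots,(\xi_k)_M)$ and $\xi_M$ is the fundamental vector field of $\xi\in\mathfrak g$. The $k$-connection is principal if $\omega^k(g\mathbf v_m)=g\,\omega^k(\mathbf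 v_m)$ for all $g\in G$ (componentwise tangent action). The horizontal lift of a $k$-vector field $\mathbf Y$ on $M/G$ is $\mathbf Y^H(m)=\gamma^k(m,\mathbf Y(\pi_M(m)))$. A horizontal lift of an integral section $\breve\phi:\mathbb R^k\to M/G$ of $\breve{\mathbf X}$ is a map $\breve\phi_H:\mathbb R^k\to M$ with $\pi_M\circ\breve\phi_H=\breve\phi$ that is an integral section of $\breve{\mathbf X}^H$. For $g:\mathbb R^k\to G$, $g^{-1}g^{(1)}:\mathbb R^k\to\mathfrak g^k$ has $\alpha$-th component $T_{g(t)}L_{g(t)^{-1}}\left(T_tg(\partial/\partial t^\alpha|_t)\right)$. *)

theory Defs
  imports "HOL-Analysis.Analysis" "HOL-Algebra.Group_Action"
begin

section \<open>Smooth manifolds\<close>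

text \<open>A chart is its domain together with the coordinate map, and a manifold is given by an atlas
  (not required to be maximal); the underlying set is the union of the chart domains. Model spaces
  are taken in class \<open>real_normed_vector\<close> and required to be finite-dimensional: unlike those of
  class \<open>euclidean_space\<close>, they may be trivial, so that discrete groups and one-point quotients are
  not excluded.\<close>

type_synonym ('a, 'e) chart = "'a set \<times> ('a \<Rightarrow> 'e)"

primrec Ck_on :: "nat \<Rightarrow> 'a::real_normed_vector set \<Rightarrow> ('a \<Rightarrow> 'b::real_normed_vector) \<Rightarrow> bool" where
  "Ck_on 0 S f \<longleftrightarrow> continuous_on S f"
| "Ck_on (Suc n) S f \<longleftrightarrow>
     (\<forall>x\<in>S. f differentiable (at x)) \<and> (\<forall>v. Ck_on n S (\<lambda>x. frechet_derivative f (at x) v))"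

text \<open>Only meaningful for open \<open>S\<close> in a finite-dimensional space.\<close>

definition smooth_on :: "'a::real_normed_vector set \<Rightarrow> ('a \<Rightarrow> 'b::real_normed_vector) \<Rightarrow> bool" where
  "smooth_on S f \<longleftrightarrow> (\<forall>n. Ck_on n S f)"

definition points :: "('a, 'e) chart set \<Rightarrow> 'a set" where
  "points A = (\<Union>(U, x)\<in>A. U)"

definition atlas_topology :: "('a, 'e::real_normed_vector) chart set \<Rightarrow> 'a topology" where
  "atlas_topology A = topology_generated_by {U \<inter> x -` O' | U x O'. (U, x) \<in> A \<and> open O'}"

definition smooth_atlas :: "('a, 'e::real_normed_vector) chart set \<Rightarrow> bool" where
  "smooth_atlas A \<longleftrightarrow>
     (\<forall>(U, x)\<in>A. inj_on x U \<and> open (x ` U)) \<and>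
     (\<forall>(U, x)\<in>A. \<forall>(V, y)\<in>A. open (x ` (U \<inter> V)) \<and> smooth_on (x ` (U \<inter> V)) (y \<circ> inv_into U x))"

definition smooth_manifold :: "('a, 'e::real_normed_vector) chart set \<Rightarrow> bool" where
  "smooth_manifold A \<longleftrightarrow>
     (\<exists>S::'e set. finite S \<and> span S = UNIV) \<and>
     smooth_atlas A \<and>
     Hausdorff_space (atlas_topology A) \<and> second_countable (atlas_topology A)"

text \<open>Openness of \<open>x ` (U \<inter> f -` V)\<close> for all charts expresses continuity of \<open>f\<close>.\<close>

definition smooth_map ::
  "('a, 'e::real_normed_vector) chart set \<Rightarrow> ('b, 'f::real_normed_vector) chart set \<Rightarrow> ('a \<Rightarrow> 'b) \<Rightarrow> bool" where
  "smooth_map A B f \<longleftrightarrow>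
     f \<in> points A \<rightarrow> points B \<and>
     (\<forall>(U, x)\<in>A. \<forall>(V, y)\<in>B.
        open (x ` (U \<inter> f -` V)) \<and> smooth_on (x ` (U \<inter> f -` V)) (y \<circ> f \<circ> inv_into U x))"

definition diffeomorphism ::
  "('a, 'e::real_normed_vector) chart set \<Rightarrow> ('b, 'f::real_normed_vector) chart set \<Rightarrow> ('a \<Rightarrow> 'b) \<Rightarrow> bool" where
  "diffeomorphism A B f \<longleftrightarrow>
     bij_betw f (points A) (points B) \<and> smooth_map A B f \<and> smooth_map B A (inv_into (points A) f)"

definition prod_atlas :: "('a, 'e) chart set \<Rightarrow> ('b, 'f) chart set \<Rightarrow> ('a \<times> 'b, 'e \<times> 'f) chart set" where
  "prod_atlas A B = {(U \<times> V, map_prod x y) | U x V y. (U, x) \<in> A \<and> (V, y) \<in> B}"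

definition restrict_atlas :: "('a, 'e) chart set \<Rightarrow> 'a set \<Rightarrow> ('a, 'e) chart set" where
  "restrict_atlas A W = {(U \<inter> W, x) | U x. (U, x) \<in> A}"

definition euclidean_atlas :: "'e::real_normed_vector set \<Rightarrow> ('e, 'e) chart set" where
  "euclidean_atlas U = {(U, id)}"


section \<open>Tangent vectors\<close>

text \<open>A tangent vector at \<open>p\<close> is the family of its coordinate representations in all charts around
  \<open>p\<close>, related by the derivatives of the coordinate changes. Entries at other charts are set to
  zero, so that equality of tangent vectors is equality of functions and the vector space
  operations are pointwise. The base point is not part of the vector and is carried separately.\<close>

type_synonym ('a, 'e) tvec = "('a, 'e) chart \<Rightarrow> 'e"

definition tangent_space :: "('a, 'e::real_normed_vector) chart set \<Rightarrow> 'a \<Rightarrow> ('a, 'e) tvec set" where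
  "tangent_space A p = {v.
     (\<forall>(U, x)\<in>A. \<forall>(V, y)\<in>A. p \<in> U \<inter> V \<longrightarrow>
        v (V, y) = frechet_derivative (y \<circ> inv_into U x) (at (x p)) (v (U, x))) \<and>
     (\<forall>c. \<not> (c \<in> A \<and> p \<in> fst c) \<longrightarrow> v c = 0)}"

text \<open>By the chain rule the value of \<open>tangent_map\<close> on \<open>tangent_space A p\<close> does not depend on the
  chart that is selected around \<open>p\<close>.\<close>

definition chart_at :: "('a, 'e) chart set \<Rightarrow> 'a \<Rightarrow> ('a, 'e) chart" where
  "chart_at A p = (SOME c. c \<in> A \<and> p \<in> fst c)"

definition tangent_map ::
  "('a, 'e::real_normed_vector) chart set \<Rightarrow> ('b, 'f::real_normed_vector) chart set \<Rightarrow> ('a \<Rightarrow> 'b) \<Rightarrow>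
   'a \<Rightarrow> ('a, 'e) tvec \<Rightarrow> ('b, 'f) tvec" where
  "tangent_map A B f p v = (\<lambda>(V, y).
     if (V, y) \<in> B \<and> f p \<in> V
     then (let (U, x) = chart_at A p
           in frechet_derivative (y \<circ> f \<circ> inv_into U x) (at (x p)) (v (U, x)))
     else 0)"


section \<open>k-tangent bundles and k-vector fields\<close>

text \<open>Tuples are indexed by a finite type \<open>'k\<close> with \<open>k = CARD('k)\<close>, and \<open>\<real>\<^sup>k\<close> is \<open>real ^ 'k\<close>.
  An element of \<open>T\<^sup>1\<^sub>kM\<close> is a pair of a base point and a \<open>'k\<close>-tuple of tangent vectors there.\<close>

definition k_tangent_space ::
  "('a, 'e::real_normed_vector) chart set \<Rightarrow> 'a \<Rightarrow> ('k::finite \<Rightarrow> ('a, 'e) tvec) set" where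
  "k_tangent_space A p = {v. \<forall>\<alpha>. v \<alpha> \<in> tangent_space A p}"

definition k_tangent_map ::
  "('a, 'e::real_normed_vector) chart set \<Rightarrow> ('b, 'f::real_normed_vector) chart set \<Rightarrow> ('a \<Rightarrow> 'b) \<Rightarrow>
   'a \<Rightarrow> ('k::finite \<Rightarrow> ('a, 'e) tvec) \<Rightarrow> 'k \<Rightarrow> ('b, 'f) tvec" where
  "k_tangent_map A B f p v = (\<lambda>\<alpha>. tangent_map A B f p (v \<alpha>))"

definition k_tangent_atlas ::
  "('a, 'e::real_normed_vector) chart set \<Rightarrow>
   ('a \<times> ('k::finite \<Rightarrow> ('a, 'e) tvec), 'e \<times> ('e ^ 'k)) chart set" where
  "k_tangent_atlas A =
     {({(p, v). p \<in> U \<and> v \<in> k_tangent_space A p}, \<lambda>(p, v). (x p, \<chi> \<alpha>. v \<alpha> (U, x))) | U x. (U, x) \<in> A}"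

text \<open>The pullback bundle \<open>M \<times>\<^bsub>N\<^esub> T\<^sup>1\<^sub>kN\<close> along \<open>f : M \<rightarrow> N\<close>, with its elements \<open>(m, (f m, w))\<close>
  written as \<open>(m, w)\<close>.\<close>

definition pullback_atlas ::
  "('a, 'e::real_normed_vector) chart set \<Rightarrow> ('b, 'f::real_normed_vector) chart set \<Rightarrow> ('a \<Rightarrow> 'b) \<Rightarrow>
   ('a \<times> ('k::finite \<Rightarrow> ('b, 'f) tvec), 'e \<times> ('f ^ 'k)) chart set" where
  "pullback_atlas A B f =
     {({(m, w). m \<in> U \<and> f m \<in> V \<and> w \<in> k_tangent_space B (f m)}, \<lambda>(m, w). (x m, \<chi> \<alpha>. w \<alpha> (V, y)))
      | U x V y. (U, x) \<in> A \<and> (V, y) \<in> B}"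

definition k_vector_field ::
  "('a, 'e::real_normed_vector) chart set \<Rightarrow> ('a \<Rightarrow> 'k::finite \<Rightarrow> ('a, 'e) tvec) \<Rightarrow> bool" where
  "k_vector_field A X \<longleftrightarrow>
     (\<forall>p\<in>points A. X p \<in> k_tangent_space A p) \<and> smooth_map A (k_tangent_atlas A) (\<lambda>p. (p, X p))"

text \<open>\<open>coord_vec U \<alpha>\<close> is \<open>\<partial>/\<partial>t\<^sup>\<alpha>\<close> at any point of the open set \<open>U \<subseteq> \<real>\<^sup>k\<close>.\<close>

definition coord_vec :: "(real ^ 'k) set \<Rightarrow> 'k::finite \<Rightarrow> (real ^ 'k, real ^ 'k) tvec" where
  "coord_vec U \<alpha> = (\<lambda>c. if c = (U, id) then axis \<alpha> 1 else 0)"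

definition prolongation ::
  "(real ^ 'k::finite) set \<Rightarrow> ('a, 'e::real_normed_vector) chart set \<Rightarrow> (real ^ 'k \<Rightarrow> 'a) \<Rightarrow>
   real ^ 'k \<Rightarrow> 'k \<Rightarrow> ('a, 'e) tvec" where
  "prolongation U A \<psi> t = k_tangent_map (euclidean_atlas U) A \<psi> t (coord_vec U)"

definition integral_section_on ::
  "(real ^ 'k::finite) set \<Rightarrow> ('a, 'e::real_normed_vector) chart set \<Rightarrow>
   ('a \<Rightarrow> 'k \<Rightarrow> ('a, 'e) tvec) \<Rightarrow> (real ^ 'k \<Rightarrow> 'a) \<Rightarrow> bool" where
  "integral_section_on U A X \<psi> \<longleftrightarrow>
     open U \<and> smooth_map (euclidean_atlas U) A \<psi> \<and> (\<forall>t\<in>U. prolongation U A \<psi> t = X (\<psi> t))"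

abbreviation integral_section ::
  "('a, 'e::real_normed_vector) chart set \<Rightarrow> ('a \<Rightarrow> 'k::finite \<Rightarrow> ('a, 'e) tvec) \<Rightarrow>
   (real ^ 'k \<Rightarrow> 'a) \<Rightarrow> bool" where
  "integral_section \<equiv> integral_section_on UNIV"

definition integrable_k_vector_field ::
  "('a, 'e::real_normed_vector) chart set \<Rightarrow> ('a \<Rightarrow> 'k::finite \<Rightarrow> ('a, 'e) tvec) \<Rightarrow> bool" where
  "integrable_k_vector_field A X \<longleftrightarrow>
     (\<forall>p\<in>points A. \<exists>U \<psi>. 0 \<in> U \<and> \<psi> 0 = p \<and> integral_section_on U A X \<psi>)"


section \<open>Lie groups, actions and principal bundles\<close>

definition lie_group ::
  "('g, 'r) monoid_scheme \<Rightarrow> ('g, 'e::real_normed_vector) chart set \<Rightarrow> bool" where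
  "lie_group G AG \<longleftrightarrow>
     group G \<and> smooth_manifold AG \<and> points AG = carrier G \<and>
     smooth_map (prod_atlas AG AG) AG (\<lambda>(g, h). g \<otimes>\<^bsub>G\<^esub> h) \<and>
     smooth_map AG AG (\<lambda>g. inv\<^bsub>G\<^esub> g)"

definition smooth_action ::
  "('g, 'r) monoid_scheme \<Rightarrow> ('g, 'e::real_normed_vector) chart set \<Rightarrow>
   ('m, 'f::real_normed_vector) chart set \<Rightarrow> ('g \<Rightarrow> 'm \<Rightarrow> 'm) \<Rightarrow> bool" where
  "smooth_action G AG AM act \<longleftrightarrow>
     group_action G (points AM) act \<and> smooth_map (prod_atlas AG AM) AM (\<lambda>(g, m). act g m)"

definition free_action :: "('g, 'r) monoid_scheme \<Rightarrow> 'm set \<Rightarrow> ('g \<Rightarrow> 'm \<Rightarrow> 'm) \<Rightarrow> bool" where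
  "free_action G M act \<longleftrightarrow> (\<forall>m\<in>M. stabilizer G act m = {\<one>\<^bsub>G\<^esub>})"

definition proper_action ::
  "('g, 'e::real_normed_vector) chart set \<Rightarrow> ('m, 'f::real_normed_vector) chart set \<Rightarrow>
   ('g \<Rightarrow> 'm \<Rightarrow> 'm) \<Rightarrow> bool" where
  "proper_action AG AM act \<longleftrightarrow>
     proper_map (prod_topology (atlas_topology AG) (atlas_topology AM))
       (prod_topology (atlas_topology AM) (atlas_topology AM))
       (\<lambda>(g, m). (act g m, m))"

text \<open>\<open>AQ\<close> is a smooth structure on the orbit set \<open>M/G\<close> for which the projection
  \<open>orbit G act : M \<rightarrow> M/G\<close> is a principal \<open>G\<close>-bundle. For a free and proper action there is one,
  and it is unique up to equivalence of atlases.\<close>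

definition principal_bundle ::
  "('g, 'r) monoid_scheme \<Rightarrow> ('g, 'e::real_normed_vector) chart set \<Rightarrow>
   ('m, 'f::real_normed_vector) chart set \<Rightarrow> ('g \<Rightarrow> 'm \<Rightarrow> 'm) \<Rightarrow>
   ('m set, 'h::real_normed_vector) chart set \<Rightarrow> bool" where
  "principal_bundle G AG AM act AQ \<longleftrightarrow>
     smooth_manifold AQ \<and> points AQ = orbits G (points AM) act \<and>
     smooth_map AM AQ (orbit G act) \<and>
     (\<forall>q\<in>points AQ. \<exists>W \<tau>. q \<in> W \<and> openin (atlas_topology AQ) W \<and>
        (let P = {m \<in> points AM. orbit G act m \<in> W} in
          diffeomorphism (restrict_atlas AM P) (prod_atlas AG (restrict_atlas AQ W))
            (\<lambda>m. (\<tau> m, orbit G act m)) \<and>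
          (\<forall>g\<in>carrier G. \<forall>m\<in>P. \<tau> (act g m) = g \<otimes>\<^bsub>G\<^esub> \<tau> m)))"

definition invariant_k_vector_field ::
  "('g, 'r) monoid_scheme \<Rightarrow> ('m, 'f::real_normed_vector) chart set \<Rightarrow> ('g \<Rightarrow> 'm \<Rightarrow> 'm) \<Rightarrow>
   ('m \<Rightarrow> 'k::finite \<Rightarrow> ('m, 'f) tvec) \<Rightarrow> bool" where
  "invariant_k_vector_field G AM act X \<longleftrightarrow>
     (\<forall>g\<in>carrier G. \<forall>m\<in>points AM. X (act g m) = k_tangent_map AM AM (act g) m (X m))"

definition reduced_k_vector_field ::
  "('g, 'r) monoid_scheme \<Rightarrow> ('m, 'f::real_normed_vector) chart set \<Rightarrow> ('g \<Rightarrow> 'm \<Rightarrow> 'm) \<Rightarrow>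
   ('m set, 'h::real_normed_vector) chart set \<Rightarrow>
   ('m \<Rightarrow> 'k::finite \<Rightarrow> ('m, 'f) tvec) \<Rightarrow> ('m set \<Rightarrow> 'k \<Rightarrow> ('m set, 'h) tvec) \<Rightarrow> bool" where
  "reduced_k_vector_field G AM act AQ X Y \<longleftrightarrow>
     k_vector_field AQ Y \<and>
     (\<forall>m\<in>points AM. k_tangent_map AM AQ (orbit G act) m (X m) = Y (orbit G act m))"


section \<open>k-connections\<close>

text \<open>Being over \<open>M\<close>, a \<open>k\<close>-connection is written \<open>(m, w) \<mapsto> (m, \<gamma> m w)\<close>, where \<open>w\<close> is a
  \<open>'k\<close>-tuple of tangent vectors of \<open>M/G\<close> at \<open>orbit G act m\<close>.\<close>

definition k_connection ::
  "('g, 'r) monoid_scheme \<Rightarrow> ('m, 'f::real_normed_vector) chart set \<Rightarrow> ('g \<Rightarrow> 'm \<Rightarrow> 'm) \<Rightarrow>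
   ('m set, 'h::real_normed_vector) chart set \<Rightarrow>
   ('m \<Rightarrow> ('k::finite \<Rightarrow> ('m set, 'h) tvec) \<Rightarrow> 'k \<Rightarrow> ('m, 'f) tvec) \<Rightarrow> bool" where
  "k_connection G AM act AQ \<gamma> \<longleftrightarrow>
     smooth_map (pullback_atlas AM AQ (orbit G act)) (k_tangent_atlas AM) (\<lambda>(m, w). (m, \<gamma> m w)) \<and>
     (\<forall>m\<in>points AM. \<forall>w\<in>k_tangent_space AQ (orbit G act m). \<forall>w'\<in>k_tangent_space AQ (orbit G act m).
        \<forall>a b. \<gamma> m (\<lambda>\<alpha> c. a *\<^sub>R w \<alpha> c + b *\<^sub>R w' \<alpha> c) = (\<lambda>\<alpha> c. a *\<^sub>R \<gamma> m w \<alpha> c + b *\<^sub>R \<gamma> m w' \<alpha> c)) \<and>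
     (\<forall>m\<in>points AM. \<forall>w\<in>k_tangent_space AQ (orbit G act m).
        k_tangent_map AM AQ (orbit G act) m (\<gamma> m w) = w)"

definition vertical_projection ::
  "('g, 'r) monoid_scheme \<Rightarrow> ('m, 'f::real_normed_vector) chart set \<Rightarrow> ('g \<Rightarrow> 'm \<Rightarrow> 'm) \<Rightarrow>
   ('m set, 'h::real_normed_vector) chart set \<Rightarrow>
   ('m \<Rightarrow> ('k::finite \<Rightarrow> ('m set, 'h) tvec) \<Rightarrow> 'k \<Rightarrow> ('m, 'f) tvec) \<Rightarrow>
   'm \<Rightarrow> ('k \<Rightarrow> ('m, 'f) tvec) \<Rightarrow> 'k \<Rightarrow> ('m, 'f) tvec" where
  "vertical_projection G AM act AQ \<gamma> m v =
     (\<lambda>\<alpha> c. v \<alpha> c - \<gamma> m (k_tangent_map AM AQ (orbit G act) m v) \<alpha> c)"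

definition principal_k_connection ::
  "('g, 'r) monoid_scheme \<Rightarrow> ('m, 'f::real_normed_vector) chart set \<Rightarrow> ('g \<Rightarrow> 'm \<Rightarrow> 'm) \<Rightarrow>
   ('m set, 'h::real_normed_vector) chart set \<Rightarrow>
   ('m \<Rightarrow> ('k::finite \<Rightarrow> ('m set, 'h) tvec) \<Rightarrow> 'k \<Rightarrow> ('m, 'f) tvec) \<Rightarrow> bool" where
  "principal_k_connection G AM act AQ \<gamma> \<longleftrightarrow>
     k_connection G AM act AQ \<gamma> \<and>
     (\<forall>g\<in>carrier G. \<forall>m\<in>points AM. \<forall>v\<in>k_tangent_space AM m.
        vertical_projection G AM act AQ \<gamma> (act g m) (k_tangent_map AM AM (act g) m v) =
        k_tangent_map AM AM (act g) m (vertical_projection G AM act AQ \<gamma> m v))"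

text \<open>The Lie algebra is \<open>tangent_space AG \<one>\<close>, and \<open>\<xi>\<^sub>M(m)\<close> is the image of \<open>\<xi>\<close> under the tangent
  map at \<open>\<one>\<close> of \<open>g \<mapsto> g m\<close>.\<close>

definition fundamental_field ::
  "('g, 'r) monoid_scheme \<Rightarrow> ('g, 'e::real_normed_vector) chart set \<Rightarrow>
   ('m, 'f::real_normed_vector) chart set \<Rightarrow> ('g \<Rightarrow> 'm \<Rightarrow> 'm) \<Rightarrow>
   ('g, 'e) tvec \<Rightarrow> 'm \<Rightarrow> ('m, 'f) tvec" where
  "fundamental_field G AG AM act \<xi> m = tangent_map AG AM (\<lambda>g. act g m) \<one>\<^bsub>G\<^esub> \<xi>"

text \<open>Since the action is free, \<open>\<theta>\<close> is determined by these conditions, including its smoothness.\<close>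

definition connection_form ::
  "('g, 'r) monoid_scheme \<Rightarrow> ('g, 'e::real_normed_vector) chart set \<Rightarrow>
   ('m, 'f::real_normed_vector) chart set \<Rightarrow> ('g \<Rightarrow> 'm \<Rightarrow> 'm) \<Rightarrow>
   ('m set, 'h::real_normed_vector) chart set \<Rightarrow>
   ('m \<Rightarrow> ('k::finite \<Rightarrow> ('m set, 'h) tvec) \<Rightarrow> 'k \<Rightarrow> ('m, 'f) tvec) \<Rightarrow>
   ('m \<Rightarrow> ('k \<Rightarrow> ('m, 'f) tvec) \<Rightarrow> 'k \<Rightarrow> ('g, 'e) tvec) \<Rightarrow> bool" where
  "connection_form G AG AM act AQ \<gamma> \<theta> \<longleftrightarrow>
     (\<forall>m\<in>points AM. \<forall>v\<in>k_tangent_space AM m.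
        \<theta> m v \<in> k_tangent_space AG \<one>\<^bsub>G\<^esub> \<and>
        vertical_projection G AM act AQ \<gamma> m v = (\<lambda>\<alpha>. fundamental_field G AG AM act (\<theta> m v \<alpha>) m))"

definition horizontal_lift_field ::
  "('g, 'r) monoid_scheme \<Rightarrow> ('g \<Rightarrow> 'm \<Rightarrow> 'm) \<Rightarrow>
   ('m \<Rightarrow> ('k::finite \<Rightarrow> ('m set, 'h::real_normed_vector) tvec) \<Rightarrow> 'k \<Rightarrow> ('m, 'f::real_normed_vector) tvec) \<Rightarrow>
   ('m set \<Rightarrow> 'k \<Rightarrow> ('m set, 'h) tvec) \<Rightarrow> 'm \<Rightarrow> 'k \<Rightarrow> ('m, 'f) tvec" where
  "horizontal_lift_field G act \<gamma> Y m = \<gamma> m (Y (orbit G act m))"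

definition horizontal_lift_section ::
  "('g, 'r) monoid_scheme \<Rightarrow> ('m, 'f::real_normed_vector) chart set \<Rightarrow> ('g \<Rightarrow> 'm \<Rightarrow> 'm) \<Rightarrow>
   ('m \<Rightarrow> ('k::finite \<Rightarrow> ('m set, 'h::real_normed_vector) tvec) \<Rightarrow> 'k \<Rightarrow> ('m, 'f) tvec) \<Rightarrow>
   ('m set \<Rightarrow> 'k \<Rightarrow> ('m set, 'h) tvec) \<Rightarrow> (real ^ 'k \<Rightarrow> 'm set) \<Rightarrow> (real ^ 'k \<Rightarrow> 'm) \<Rightarrow> bool" where
  "horizontal_lift_section G AM act \<gamma> Y \<psi> \<psi>\<^sub>H \<longleftrightarrow>
     (\<forall>t. orbit G act (\<psi>\<^sub>H t) = \<psi> t) \<and>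
     integral_section AM (horizontal_lift_field G act \<gamma> Y) \<psi>\<^sub>H"

text \<open>The first prolongation translated back to the identity.\<close>

definition left_log_derivative ::
  "('g, 'r) monoid_scheme \<Rightarrow> ('g, 'e::real_normed_vector) chart set \<Rightarrow>
   (real ^ 'k::finite \<Rightarrow> 'g) \<Rightarrow> real ^ 'k \<Rightarrow> 'k \<Rightarrow> ('g, 'e) tvec" where
  "left_log_derivative G AG g t =
     k_tangent_map AG AG (\<lambda>h. inv\<^bsub>G\<^esub> (g t) \<otimes>\<^bsub>G\<^esub> h) (g t) (prolongation UNIV AG g t)"

end

theory Submission
  imports Defs
begin

text \<open>Put \<open>m = \<phi>\<^sub>H t\<close>. By the product rule, \<open>T\<phi>(\<partial>\<^sub>\<alpha>)\<close> at \<open>t\<close> is the sum of the derivatives of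
  \<open>s \<mapsto> g(s) m\<close> and \<open>s \<mapsto> g(t) \<phi>\<^sub>H(s)\<close>. Writing \<open>g(s) m = g(t) ((g(t)\<inverse> g(s)) m)\<close>, the first one is
  \<open>g(t)\<close> applied to the fundamental vector of \<open>g\<inverse> \<partial>\<^sub>\<alpha>g\<close> at \<open>m\<close>, which by the reconstruction equation
  is the vertical part of \<open>X(m)\<close>; the second one is \<open>g(t)\<close> applied to the horizontal lift of the
  reduced field, the horizontal part of \<open>X(m)\<close>. Hence \<open>T\<phi>(\<partial>\<^sub>\<alpha>) = g(t) X\<^sub>\<alpha>(m) = X\<^sub>\<alpha>(g(t) m)\<close> by
  invariance.\<close>

section \<open>Coordinates in finite-dimensional normed spaces\<close>

text \<open>Model spaces carry only a norm, so continuity of the coordinate functionals has to be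
  derived. When \<open>a\<close> is added to \<open>B\<close>, its positive distance
  \<open>d\<close> from the span of \<open>B\<close> controls its own coefficient; removing
  \<open>u a *\<^sub>R a\<close> leaves a combination of \<open>B\<close> covered by the induction
  hypothesis.\<close>

lemma independent_coefficient_bound:
  fixes B :: "'a::real_normed_vector set"
  assumes "finite B" and "independent B"
  shows "\<exists>C\<ge>0. \<forall>u. \<forall>b\<in>B. \<bar>u b\<bar> \<le> C * norm (\<Sum>b\<in>B. u b *\<^sub>R b)"
  using assms
proof (induction B rule: finite_induct)
  case empty
  show ?case by (intro exI[of _ 0]) simp
next
  case (insert a B)
  from insert.prems insert.hyps have "independent B" and a: "a \<notin> span B"
    by (simp_all add: independent_insert)
  with insert.IH obtain C where C: "C \<ge> 0"
    "\<And>u b. b \<in> B \<Longrightarrow> \<bar>u b\<bar> \<le> C * norm (\<Sum>b\<in>B. u b *\<^sub>R b)" by blast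
  \<comment> \<open>The inductive bound makes the span of \<open>B\<close> complete, so \<open>a\<close> has positive distance to it.\<close>
  have "\<exists>d>0. \<forall>u. d \<le> norm (a + (\<Sum>b\<in>B. u b *\<^sub>R b))"
  proof (rule ccontr)
    assume *: "\<not> ?thesis"
    have "\<exists>u. norm (a + (\<Sum>b\<in>B. u b *\<^sub>R b)) < inverse (real (Suc n))" for n
    proof -
      have "inverse (real (Suc n)) > 0" by simp
      with * show ?thesis by (meson not_le)
    qed
    then have "\<exists>u. \<forall>n. norm (a + (\<Sum>b\<in>B. u n b *\<^sub>R b)) < inverse (real (Suc n))"
      by (intro choice allI)
    then obtain u where u: "\<And>n. norm (a + (\<Sum>b\<in>B. u n b *\<^sub>R b)) < inverse (real (Suc n))"
      by blast
    define s where "s n = (\<Sum>b\<in>B. u n b *\<^sub>R b)" for n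
    have "(\<lambda>n. a + s n) \<longlonglongrightarrow> 0"
    proof (rule Lim_null_comparison[OF always_eventually LIMSEQ_inverse_real_of_nat], rule allI)
      show "norm (a + s n) \<le> inverse (real (Suc n))" for n
        using u[of n] by (simp only: s_def less_imp_le)
    qed
    then have "(\<lambda>n. (a + s n) - a) \<longlonglongrightarrow> 0 - a"
      by (intro tendsto_diff tendsto_const)
    then have lim: "s \<longlonglongrightarrow> - a" by simp
    then have "Cauchy s" by (rule LIMSEQ_imp_Cauchy)
    have "convergent (\<lambda>n. u n b)" if "b \<in> B" for b
    proof -
      have diff: "\<bar>u m b - u n b\<bar> \<le> C * norm (s m - s n)" for m n
        using C(2)[OF that, of "\<lambda>b. u m b - u n b"]
        by (simp add: s_def scaleR_left_diff_distrib sum_subtractf)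
      have "Cauchy (\<lambda>n. u n b)"
      proof (rule metric_CauchyI)
        fix e :: real assume "e > 0"
        \<comment> \<open>\<open>C\<close> may be 0, so the denominator is
          \<open>C + 1\<close>.\<close>
        with C(1) have "e / (C + 1) > 0" by simp
        from metric_CauchyD[OF \<open>Cauchy s\<close> this] obtain M
          where M: "\<And>m n. m \<ge> M \<Longrightarrow> n \<ge> M \<Longrightarrow> dist (s m) (s n) < e / (C + 1)" by blast
        have "dist (u m b) (u n b) < e" if "m \<ge> M" "n \<ge> M" for m n
        proof -
          have "\<bar>u m b - u n b\<bar> \<le> (C + 1) * norm (s m - s n)"
            using diff[of m n] using order_trans[OF diff, of m n] by (simp add: algebra_simps)
          also have "\<dots> < e"
            using M[OF that] C(1) by (simp add: dist_norm field_simps)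
          finally show ?thesis by (simp add: dist_norm)
        qed
        then show "\<exists>M. \<forall>m\<ge>M. \<forall>n\<ge>M. dist (u m b) (u n b) < e" by blast
      qed
      then show ?thesis by (rule Cauchy_convergent)
    qed
    then have "\<forall>b\<in>B. \<exists>l. (\<lambda>n. u n b) \<longlonglongrightarrow> l" unfolding convergent_def by blast
    then obtain l where l: "\<And>b. b \<in> B \<Longrightarrow> (\<lambda>n. u n b) \<longlonglongrightarrow> l b" by metis
    \<comment> \<open>Convergence of the coefficients exhibits the limit \<open>- a\<close> as an
      element of the span of \<open>B\<close>.\<close>
    have "s \<longlonglongrightarrow> (\<Sum>b\<in>B. l b *\<^sub>R b)"
      unfolding s_def by (intro tendsto_sum tendsto_scaleR l tendsto_const)
    with lim have "- a = (\<Sum>b\<in>B. l b *\<^sub>R b)" by (rule LIMSEQ_unique)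
    also have "\<dots> \<in> span B" by (intro span_sum span_scale span_base)
    finally have "a \<in> span B" using span_neg[of "- a"] by simp
    with a show False by simp
  qed
  then obtain d where d: "d > 0" "\<And>u. d \<le> norm (a + (\<Sum>b\<in>B. u b *\<^sub>R b))" by blast
  \<comment> \<open>The first summand serves the coefficient of \<open>a\<close>. The second serves
    the others, since removing \<open>u a *\<^sub>R a\<close> from the whole sum enlarges its norm
    at most by the factor \<open>1 + norm a / d\<close>.\<close>
  define K where "K = inverse d + C * (1 + norm a / d)"
  have bound: "\<bar>u b\<bar> \<le> K * norm (\<Sum>b\<in>insert a B. u b *\<^sub>R b)" if "b \<in> insert a B" for u b
  proof -
    define w v where "w = (\<Sum>b\<in>B. u b *\<^sub>R b)" and "v = u a *\<^sub>R a + w"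
    have v: "(\<Sum>b\<in>insert a B. u b *\<^sub>R b) = v"
      using insert.hyps by (simp add: v_def w_def)
    \<comment> \<open>Dividing by \<open>u a\<close> gives \<open>a\<close> plus a combination of
      \<open>B\<close>, the form to which the distance bound applies.\<close>
    have ua: "\<bar>u a\<bar> * d \<le> norm v"
    proof (cases "u a = 0")
      case False
      then have "v = u a *\<^sub>R (a + (\<Sum>b\<in>B. (u b / u a) *\<^sub>R b))"
        by (simp add: v_def w_def scaleR_right_distrib scaleR_sum_right)
      then have "norm v = \<bar>u a\<bar> * norm (a + (\<Sum>b\<in>B. (u b / u a) *\<^sub>R b))" by simp
      then show ?thesis using d(2)[of "\<lambda>b. u b / u a"] by (simp add: mult_left_mono)
    qed simp
    then have ua': "\<bar>u a\<bar> \<le> norm v / d" using d(1) by (simp add: field_simps)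
    show ?thesis
    proof (cases "b = a")
      case True
      have "0 \<le> C * (1 + norm a / d) * norm v" using C(1) d(1) by simp
      with True ua' show ?thesis unfolding v K_def by (simp add: algebra_simps divide_inverse)
    next
      case False
      with that have "\<bar>u b\<bar> \<le> C * norm w" using C(2) by (auto simp: w_def)
      also have "norm w \<le> norm v + \<bar>u a\<bar> * norm a"
        using norm_triangle_ineq4[of v "u a *\<^sub>R a"] by (simp add: v_def)
      also have "\<dots> \<le> norm v + norm v / d * norm a"
        using mult_right_mono[OF ua' norm_ge_zero[of a]] by simp
      finally have "\<bar>u b\<bar> \<le> C * (norm v + norm v / d * norm a)"
        using C(1) by (simp add: mult_left_mono)
      also have "\<dots> \<le> K * norm v"
        using d(1) by (simp add: K_def algebra_simps)
      finally show ?thesis unfolding v .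
    qed
  qed
  have "K \<ge> 0" using C(1) d(1) by (simp add: K_def)
  with bound show ?case by blast
qed

text \<open>A maximal independent subset of \<open>S\<close> is a finite basis, and the coefficient
  bound makes its representation functionals bounded. These coordinates expand derivatives in the
  chain rule for \<open>Ck_on\<close>.\<close>

lemma finite_dimensional_coordinates:
  fixes S :: "'a::real_normed_vector set"
  assumes "finite S" and "span S = UNIV"
  shows "\<exists>(B::'a set) c. finite B \<and> (\<forall>b\<in>B. bounded_linear (c b)) \<and>
    (\<forall>v. (\<Sum>b\<in>B. c b v *\<^sub>R b) = v)"
proof -
  obtain B where B: "B \<subseteq> S" "independent B" "S \<subseteq> span B"
    by (rule maximal_independent_subset)
  have fin: "finite B" using B(1) assms(1) by (rule finite_subset)
  have span: "v \<in> span B" for v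
    using span_mono[OF B(3)] assms(2) by (auto simp: span_span)
  define c where "c b v = representation B v b" for b v
  have eq: "(\<Sum>b\<in>B. c b v *\<^sub>R b) = v" for v
    unfolding c_def using sum_representation_eq[OF B(2) span fin order_refl] by simp
  obtain C where C: "\<And>u b. b \<in> B \<Longrightarrow> \<bar>u b\<bar> \<le> C * norm (\<Sum>b\<in>B. u b *\<^sub>R b)"
    using independent_coefficient_bound[OF fin B(2)] by blast
  have "bounded_linear (c b)" if "b \<in> B" for b
  proof (rule bounded_linear_intro)
    show "c b (x + y) = c b x + c b y" for x y
      by (simp add: c_def representation_add[OF B(2) span span])
    show "c b (r *\<^sub>R x) = r *\<^sub>R c b x" for r x
      by (simp add: c_def representation_scale[OF B(2) span])
    show "norm (c b x) \<le> norm x * C" for x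
      using C[OF that, of "\<lambda>b. c b x"] by (simp add: eq mult.commute)
  qed
  with fin eq show ?thesis by blast
qed

text \<open>The copies of the two spanning sets on the axes span together. This makes the model
  space of a product such as \<open>prod_atlas AG AM\<close> available as the middle space of a
  composition.\<close>

lemma finite_dimensional_prod:
  assumes "\<exists>S::'a::real_vector set. finite S \<and> span S = UNIV"
    and "\<exists>T::'b::real_vector set. finite T \<and> span T = UNIV"
  shows "\<exists>R::('a \<times> 'b) set. finite R \<and> span R = UNIV"
proof -
  obtain S :: "'a set" and T :: "'b set" where S: "finite S" "span S = UNIV"
    and T: "finite T" "span T = UNIV" using assms by blast
  let ?R = "(\<lambda>a. (a, 0)) ` S \<union> (\<lambda>b. (0, b)) ` T"
  have l1: "linear (\<lambda>a::'a. (a, 0::'b))" and l2: "linear (\<lambda>b::'b. (0::'a, b))"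
    by (auto intro!: linearI)
  have "(a, 0) \<in> span ?R" for a
    using linear_span_image[OF l1, of S] S(2) span_mono[of "(\<lambda>a. (a, 0)) ` S" ?R] by fastforce
  moreover have "(0, b) \<in> span ?R" for b
    using linear_span_image[OF l2, of T] T(2) span_mono[of "(\<lambda>b. (0, b)) ` T" ?R] by fastforce
  ultimately have "(a, 0) + (0, b) \<in> span ?R" for a b by (rule span_add)
  then have "span ?R = UNIV" by auto
  with S(1) T(1) show ?thesis by (intro exI[of _ ?R]) simp
qed

section \<open>Smooth functions on open sets\<close>

lemma Ck_on_Suc_derivative:
  assumes "Ck_on (Suc n) S f"
  shows "x \<in> S \<Longrightarrow> (f has_derivative frechet_derivative f (at x)) (at x)"
    and "Ck_on n S (\<lambda>x. frechet_derivative f (at x) v)"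
  using assms by (auto simp: frechet_derivative_works)

text \<open>On an open set, agreement of the functions forces agreement of their derivatives in the
  ambient space, so the induction can pass to the derivatives.\<close>

lemma Ck_on_cong:
  assumes "open S" and "\<And>x. x \<in> S \<Longrightarrow> f x = g x" and "Ck_on n S f"
  shows "Ck_on n S g"
  using assms(2,3)
proof (induction n arbitrary: f g)
  case 0
  then show ?case by (simp cong: continuous_on_cong)
next
  case (Suc n)
  note f = Ck_on_Suc_derivative[OF Suc.prems(2)]
  have D: "(g has_derivative frechet_derivative f (at x)) (at x)" if "x \<in> S" for x
    using f(1)[OF that] assms(1) that Suc.prems(1) by (rule has_derivative_transform_within_open)
  have "Ck_on n S (\<lambda>x. frechet_derivative g (at x) v)" for v
    using fun_cong[OF frechet_derivative_at[OF D]] f(2)[of v] by (rule Suc.IH)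
  with D show ?case by (auto intro: differentiableI)
qed

text \<open>Uniqueness of derivatives allows an explicit formula \<open>D\<close> in place of the
  chosen \<open>frechet_derivative\<close>.\<close>

lemma Ck_on_SucI:
  assumes "open S" and "\<And>x. x \<in> S \<Longrightarrow> (f has_derivative D x) (at x)"
    and "\<And>v. Ck_on n S (\<lambda>x. D x v)"
  shows "Ck_on (Suc n) S f"
proof -
  have "Ck_on n S (\<lambda>x. frechet_derivative f (at x) v)" for v
    using fun_cong[OF frechet_derivative_at[OF assms(2)]] assms(3)[of v] by (rule Ck_on_cong[OF assms(1)])
  with assms(2) show ?thesis by (auto intro: differentiableI)
qed

lemma Ck_on_subset:
  assumes "Ck_on n S f" and "T \<subseteq> S"
  shows "Ck_on n T f"
  using assms by (induction n arbitrary: f) (auto intro: continuous_on_subset)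

lemma Ck_on_imp_continuous_on:
  assumes "Ck_on n S f"
  shows "continuous_on S f"
proof (cases n)
  case (Suc m)
  with assms have "f differentiable (at x)" if "x \<in> S" for x using that by simp
  then show ?thesis
    by (intro continuous_at_imp_continuous_on ballI differentiable_imp_continuous_within)
qed (use assms in simp)

text \<open>The definition lowers the order only while differentiating, so this needs its own
  induction; it starts from differentiable functions being continuous.\<close>

lemma Ck_on_SucD:
  assumes "Ck_on (Suc n) S f"
  shows "Ck_on n S f"
  using assms
proof (induction n arbitrary: f)
  case 0
  then show ?case using Ck_on_imp_continuous_on by (simp del: Ck_on.simps(2))
next
  case (Suc n)
  from Suc.prems have "\<forall>x\<in>S. f differentiable (at x)"
    and "Ck_on (Suc n) S (\<lambda>x. frechet_derivative f (at x) v)" for v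
    by simp_all
  with Suc.IH show ?case by simp
qed

text \<open>Continuity and derivatives at a point are determined on any open neighbourhood. This
  glues coordinate expressions when the intermediate chart varies with the point.\<close>

lemma Ck_on_open_cover:
  assumes "\<And>x. x \<in> S \<Longrightarrow> \<exists>T. open T \<and> x \<in> T \<and> T \<subseteq> S \<and> Ck_on n T f"
  shows "Ck_on n S f"
  using assms
proof (induction n arbitrary: f)
  case 0
  have "isCont f x" if "x \<in> S" for x
    using 0[OF that] by (auto simp: continuous_on_eq_continuous_at)
  then show ?case by (simp add: continuous_at_imp_continuous_on)
next
  case (Suc n)
  have "Ck_on n S (\<lambda>x. frechet_derivative f (at x) v)" for v
    using Suc.prems by (intro Suc.IH) fastforce
  with Suc.prems show ?case by fastforce
qed

lemma Ck_on_const: "Ck_on n S (\<lambda>x. c)"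
  by (induction n arbitrary: c) simp_all

lemma Ck_on_bounded_linear:
  assumes "bounded_linear L" and "open S" and "Ck_on n S f"
  shows "Ck_on n S (\<lambda>x. L (f x))"
  using assms(3)
proof (induction n arbitrary: f)
  case 0
  then show ?case by (simp add: bounded_linear.continuous_on[OF assms(1)])
next
  case (Suc n)
  let ?D = "\<lambda>x. frechet_derivative f (at x)"
  note D = Ck_on_Suc_derivative[OF Suc.prems]
  show ?case
    by (intro D Ck_on_SucI[of _ _ "\<lambda>x v. L (?D x v)"] assms(2) Suc.IH
        bounded_linear.has_derivative[OF assms(1)])
qed

lemma Ck_on_Pair:
  assumes "open S" and "Ck_on n S f" and "Ck_on n S g"
  shows "Ck_on n S (\<lambda>x. (f x, g x))"
  using assms(2,3)
proof (induction n arbitrary: f g)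
  case 0
  then show ?case by (simp add: continuous_on_Pair)
next
  case (Suc n)
  let ?D = "\<lambda>x. frechet_derivative f (at x)"
  note D = Ck_on_Suc_derivative[OF Suc.prems(1)]
  let ?E = "\<lambda>x. frechet_derivative g (at x)"
  note E = Ck_on_Suc_derivative[OF Suc.prems(2)]
  show ?case
    by (intro D E Ck_on_SucI[of _ _ "\<lambda>x v. (?D x v, ?E x v)"] assms(1) Suc.IH has_derivative_Pair)
qed

lemma Ck_on_add:
  assumes "open S" and "Ck_on n S f" and "Ck_on n S g"
  shows "Ck_on n S (\<lambda>x. f x + g x)"
proof -
  \<comment> \<open>Addition is a bounded linear map applied to the pair of functions.\<close>
  have "bounded_linear (\<lambda>p. fst p + snd p :: 'b)"
    by (intro bounded_linear_add bounded_linear_fst bounded_linear_snd)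
  from Ck_on_bounded_linear[OF this assms(1) Ck_on_Pair[OF assms]] show ?thesis by simp
qed

lemma Ck_on_sum:
  assumes "open S" and "\<And>i. i \<in> I \<Longrightarrow> Ck_on n S (f i)"
  shows "Ck_on n S (\<lambda>x. \<Sum>i\<in>I. f i x)"
  using assms(2) by (induction I rule: infinite_finite_induct)
    (simp_all add: Ck_on_const Ck_on_add[OF assms(1)])

lemma Ck_on_scaleR:
  assumes "open S" and "Ck_on n S f" and "Ck_on n S g"
  shows "Ck_on n S (\<lambda>x. f x *\<^sub>R g x)"
  using assms(2,3)
proof (induction n arbitrary: f g)
  case 0
  then show ?case by (simp add: continuous_on_scaleR)
next
  case (Suc n)
  let ?D = "\<lambda>x. frechet_derivative f (at x)"
  note D = Ck_on_Suc_derivative[OF Suc.prems(1)]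
  let ?E = "\<lambda>x. frechet_derivative g (at x)"
  note E = Ck_on_Suc_derivative[OF Suc.prems(2)]
  \<comment> \<open>The product rule keeps one factor undifferentiated in each term; these factors
    are first lowered to order \<open>n\<close>.\<close>
  show ?case
    using Suc.prems[THEN Ck_on_SucD]
    by (intro D E Ck_on_SucI[of _ _ "\<lambda>x v. f x *\<^sub>R ?E x v + ?D x v *\<^sub>R g x"] assms(1) Suc.IH Ck_on_add
        has_derivative_scaleR)
qed

text \<open>Finite dimension of the middle space lets the derivative of the composition be expanded in
  partial derivatives, each of which is again a composition.\<close>

lemma Ck_on_compose:
  fixes f :: "'a::real_normed_vector \<Rightarrow> 'b::real_normed_vector"
  assumes "\<exists>B::'b set. finite B \<and> span B = UNIV"
    and "open S" and "open T" and "f ` S \<subseteq> T" and "Ck_on n S f" and "Ck_on n T g"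
  shows "Ck_on n S (g \<circ> f)"
proof -
  obtain S' :: "'b set" where "finite S'" "span S' = UNIV" using assms(1) by blast
  from finite_dimensional_coordinates[OF this]
  obtain B :: "'b set" and c where B: "finite B" "\<forall>b\<in>B. bounded_linear (c b)"
    "\<forall>v. (\<Sum>b\<in>B. c b v *\<^sub>R b) = v"
    by (elim exE conjE) (rule that)
  show ?thesis
    using assms(5,6)
  \<comment> \<open>Only \<open>g\<close> varies, because it gets replaced by its partial
    derivatives while the inner map remains \<open>f\<close>.\<close>
  proof (induction n arbitrary: g)
    case 0
    then show ?case
      unfolding Ck_on.simps(1) using assms(4) by (blast intro: continuous_on_compose continuous_on_subset)
  next
    case (Suc n)
    let ?D = "\<lambda>x. frechet_derivative f (at x)"
    note D = Ck_on_Suc_derivative[OF Suc.prems(1)]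
    let ?E = "\<lambda>x. frechet_derivative g (at x)"
    note E = Ck_on_Suc_derivative[OF Suc.prems(2)]
    have expand: "(\<Sum>b\<in>B. c b (?D x v) *\<^sub>R ?E (f x) b) = ?E (f x) (?D x v)" if "x \<in> S" for x v
    proof -
      have "linear (?E (f x))"
        using E(1)[of "f x"] that assms(4) by (auto intro: has_derivative_linear)
      then have "(\<Sum>b\<in>B. c b (?D x v) *\<^sub>R ?E (f x) b) = ?E (f x) (\<Sum>b\<in>B. c b (?D x v) *\<^sub>R b)"
        by (simp add: linear_sum linear_scale)
      then show ?thesis by (simp add: B(3))
    qed
    have E': "Ck_on n S (\<lambda>x. ?E (f x) b)" for b
      using Suc.IH[OF Ck_on_SucD[OF Suc.prems(1)] E(2)[of b]] by (simp add: comp_def)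
    have *: "Ck_on n S (\<lambda>x. \<Sum>b\<in>B. c b (?D x v) *\<^sub>R ?E (f x) b)" for v
      using Ck_on_bounded_linear[OF B(2)[rule_format] assms(2) D(2)]
      by (rule Ck_on_sum[OF assms(2) Ck_on_scaleR[OF assms(2) _ E']])
    show ?case
    proof (rule Ck_on_SucI[OF assms(2)])
      show "(g \<circ> f has_derivative (\<lambda>v. ?E (f x) (?D x v))) (at x)" if "x \<in> S" for x
        using diff_chain_at[OF D(1)[OF that] E(1)] that assms(4) by (auto simp: comp_def)
      show "Ck_on n S (\<lambda>x. ?E (f x) (?D x v))" for v
        by (rule Ck_on_cong[OF assms(2) expand *])
    qed
  qed
qed

section \<open>Smoothness of all orders\<close>

lemma smooth_on_imp_differentiable:
  assumes "smooth_on S f" and "x \<in> S"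
  shows "f differentiable (at x)"
proof -
  have "Ck_on (Suc 0) S f" using assms(1) unfolding smooth_on_def by (rule spec)
  with assms(2) show ?thesis by simp
qed

lemma smooth_on_imp_continuous_on: "smooth_on S f \<Longrightarrow> continuous_on S f"
  unfolding smooth_on_def using Ck_on_imp_continuous_on by blast

lemma smooth_on_const: "smooth_on S (\<lambda>x. c)"
  by (simp add: smooth_on_def Ck_on_const)

lemma smooth_on_cong:
  "open S \<Longrightarrow> (\<And>x. x \<in> S \<Longrightarrow> f x = g x) \<Longrightarrow> smooth_on S f \<Longrightarrow> smooth_on S g"
  unfolding smooth_on_def using Ck_on_cong by blast

lemma smooth_on_subset: "smooth_on S f \<Longrightarrow> T \<subseteq> S \<Longrightarrow> smooth_on T f"
  unfolding smooth_on_def using Ck_on_subset by blast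

lemma smooth_on_Pair:
  "open S \<Longrightarrow> smooth_on S f \<Longrightarrow> smooth_on S g \<Longrightarrow> smooth_on S (\<lambda>x. (f x, g x))"
  by (simp add: smooth_on_def Ck_on_Pair)

lemma smooth_on_compose:
  fixes f :: "'a::real_normed_vector \<Rightarrow> 'b::real_normed_vector"
  assumes "\<exists>B::'b set. finite B \<and> span B = UNIV"
    and "open S" and "open T" and "f ` S \<subseteq> T" and "smooth_on S f" and "smooth_on T g"
  shows "smooth_on S (g \<circ> f)"
  using assms(5,6) unfolding smooth_on_def by (simp add: Ck_on_compose[OF assms(1-4)])

lemma smooth_on_open_cover:
  assumes "\<And>x. x \<in> S \<Longrightarrow> \<exists>T. open T \<and> x \<in> T \<and> T \<subseteq> S \<and> smooth_on T f"
  shows "smooth_on S f"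
  unfolding smooth_on_def
proof
  show "Ck_on n S f" for n
    by (rule Ck_on_open_cover) (use assms in \<open>fastforce simp: smooth_on_def\<close>)
qed

section \<open>Smooth maps\<close>

lemma points_iff: "p \<in> points A \<longleftrightarrow> (\<exists>U x. (U, x) \<in> A \<and> p \<in> U)"
  by (auto simp: points_def)

lemma chart_at_cases:
  assumes "p \<in> points A"
  obtains U x where "chart_at A p = (U, x)" "(U, x) \<in> A" "p \<in> U"
proof -
  have "\<exists>c. c \<in> A \<and> p \<in> fst c" using assms by (force simp: points_iff)
  then have "chart_at A p \<in> A \<and> p \<in> fst (chart_at A p)"
    unfolding chart_at_def by (rule someI_ex)
  then show ?thesis using that by (metis prod.collapse)
qed

lemma smooth_mapD:
  assumes "smooth_map A B f"
  shows "p \<in> points A \<Longrightarrow> f p \<in> points B"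
    and "(U, x) \<in> A \<Longrightarrow> (V, y) \<in> B \<Longrightarrow> open (x ` (U \<inter> f -` V))"
    and "(U, x) \<in> A \<Longrightarrow> (V, y) \<in> B \<Longrightarrow> smooth_on (x ` (U \<inter> f -` V)) (y \<circ> f \<circ> inv_into U x)"
  using assms unfolding smooth_map_def by blast+

lemma smooth_mapI:
  assumes "\<And>p. p \<in> points A \<Longrightarrow> f p \<in> points B"
    and "\<And>U x V y. (U, x) \<in> A \<Longrightarrow> (V, y) \<in> B \<Longrightarrow> open (x ` (U \<inter> f -` V))"
    and "\<And>U x V y. (U, x) \<in> A \<Longrightarrow> (V, y) \<in> B \<Longrightarrow> smooth_on (x ` (U \<inter> f -` V)) (y \<circ> f \<circ> inv_into U x)"
  shows "smooth_map A B f"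
  unfolding smooth_map_def using assms by blast

text \<open>Near each point the coordinate expression factors through a chart of \<open>B\<close>
  around the image point; the local pieces are then glued.\<close>

lemma smooth_map_compose:
  fixes B :: "('b, 'f::real_normed_vector) chart set"
  assumes f: "smooth_map A B f" and h: "smooth_map B C h"
    and A: "\<And>U x. (U, x) \<in> A \<Longrightarrow> inj_on x U" and B: "\<And>V y. (V, y) \<in> B \<Longrightarrow> inj_on y V"
    and fin: "\<exists>S::'f set. finite S \<and> span S = UNIV"
  shows "smooth_map A C (h \<circ> f)"
proof -
  have loc: "\<exists>T. open T \<and> q \<in> T \<and> T \<subseteq> x ` (U \<inter> (h \<circ> f) -` W) \<and>
      smooth_on T (z \<circ> (h \<circ> f) \<circ> inv_into U x)"
    if U: "(U, x) \<in> A" and W: "(W, z) \<in> C" and q: "q \<in> x ` (U \<inter> (h \<circ> f) -` W)"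
    for U x W z q
  proof -
    obtain p where p: "p \<in> U" "h (f p) \<in> W" "q = x p" using q by auto
    with U have "p \<in> points A" by (auto simp: points_iff)
    then have "f p \<in> points B" by (rule smooth_mapD(1)[OF f])
    then obtain V y where V: "(V, y) \<in> B" "f p \<in> V" by (auto simp: points_iff)
    let ?S = "x ` (U \<inter> f -` V)" and ?R = "y ` (V \<inter> h -` W)"
    let ?F = "y \<circ> f \<circ> inv_into U x" and ?H = "z \<circ> h \<circ> inv_into V y"
    \<comment> \<open>The coordinates at which the factorisation \<open>?H \<circ> ?F\<close>
      through the chart \<open>y\<close> is defined; this set is open by continuity of
      \<open>?F\<close>.\<close>
    let ?T = "?S \<inter> ?F -` ?R"
    note S = smooth_mapD(2,3)[OF f U V(1)] and R = smooth_mapD(2,3)[OF h V(1) W]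
    have T: "open ?T"
      by (rule continuous_open_preimage[OF smooth_on_imp_continuous_on[OF S(2)] S(1) R(1)])
    have F: "?F (x s) = y (f s)" if "s \<in> U" for s
      using inv_into_f_f[OF A[OF U] that] by simp
    have H: "?H (y b) = z (h b)" if "b \<in> V" for b
      using inv_into_f_f[OF B[OF V(1)] that] by simp
    have sub: "?T \<subseteq> x ` (U \<inter> (h \<circ> f) -` W)"
    proof
      fix r assume "r \<in> ?T"
      then obtain s b where s: "s \<in> U" "f s \<in> V" "r = x s" "b \<in> V" "h b \<in> W" "?F r = y b" by auto
      \<comment> \<open>Membership in \<open>?R\<close> yields only some \<open>b\<close> with the
        same coordinates as \<open>f s\<close>; injectivity of \<open>y\<close> identifies the
        two.\<close>
      have "y (f s) = y b" using F[OF s(1)] s(3,6) by metis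
      with B[OF V(1)] s(2,4) have "f s = b" by (auto dest: inj_onD)
      with s show "r \<in> x ` (U \<inter> (h \<circ> f) -` W)" by auto
    qed
    have "smooth_on ?T (?H \<circ> ?F)"
      using smooth_on_subset[OF S(2)] R(2) by (intro smooth_on_compose[OF fin T R(1)]) auto
    then have "smooth_on ?T (z \<circ> (h \<circ> f) \<circ> inv_into U x)"
    proof (rule smooth_on_cong[OF T, rotated])
      fix r assume "r \<in> ?T"
      then obtain s where s: "s \<in> U" "f s \<in> V" "r = x s" by auto
      then have "(?H \<circ> ?F) r = z (h (f s))" using F H by (metis comp_apply)
      also have "\<dots> = (z \<circ> (h \<circ> f) \<circ> inv_into U x) r"
        using s(3) inv_into_f_f[OF A[OF U] s(1)] by simp
      finally show "(?H \<circ> ?F) r = (z \<circ> (h \<circ> f) \<circ> inv_into U x) r" .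
    qed
    moreover have "q \<in> ?T"
      using p V(2) F[OF p(1)] by (auto intro!: imageI)
    ultimately show ?thesis using T sub by blast
  qed
  show ?thesis
  proof (rule smooth_mapI)
    show "(h \<circ> f) p \<in> points C" if "p \<in> points A" for p
      using smooth_mapD(1)[OF h smooth_mapD(1)[OF f that]] by simp
    show "open (x ` (U \<inter> (h \<circ> f) -` W))" if "(U, x) \<in> A" "(W, z) \<in> C" for U x W z
      using loc[OF that] by (subst open_subopen) blast
    show "smooth_on (x ` (U \<inter> (h \<circ> f) -` W)) (z \<circ> (h \<circ> f) \<circ> inv_into U x)"
      if "(U, x) \<in> A" "(W, z) \<in> C" for U x W z
      using loc[OF that] by (rule smooth_on_open_cover)
  qed
qed

lemma smooth_map_const:
  assumes "\<And>U x. (U, x) \<in> A \<Longrightarrow> open (x ` U)" and "q \<in> points B"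
  shows "smooth_map A B (\<lambda>p. q)"
proof (rule smooth_mapI)
  show "open (x ` (U \<inter> (\<lambda>p. q) -` V))" if "(U, x) \<in> A" "(V, y) \<in> B" for U x V and y :: "'c \<Rightarrow> 'd"
    using assms(1)[OF that(1)] by (cases "q \<in> V") auto
qed (use assms(2) smooth_on_const in \<open>auto simp: comp_def\<close>)

text \<open>In coordinates the identity is a change of charts, so this is the compatibility clause
  of \<open>smooth_atlas\<close>.\<close>

lemma smooth_map_ident:
  assumes "smooth_atlas A"
  shows "smooth_map A A (\<lambda>p. p)"
  using assms unfolding smooth_map_def smooth_atlas_def by (fastforce simp: comp_def)

section \<open>Product atlases and maps into products\<close>

lemma prod_atlas_iff:
  "(W, z) \<in> prod_atlas A B \<longleftrightarrow>
    (\<exists>U x V y. W = U \<times> V \<and> z = map_prod x y \<and> (U, x) \<in> A \<and> (V, y) \<in> B)"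
  by (auto simp: prod_atlas_def)

lemma points_prod_atlas: "points (prod_atlas A B) = points A \<times> points B"
  by (auto simp: points_iff prod_atlas_iff) blast+

lemma inj_on_prod_chart:
  assumes "\<And>U x. (U, x) \<in> A \<Longrightarrow> inj_on x U" and "\<And>V y. (V, y) \<in> B \<Longrightarrow> inj_on y V"
    and "(W, z) \<in> prod_atlas A B"
  shows "inj_on z W"
  using assms by (auto simp: prod_atlas_iff intro!: map_prod_inj_on)

lemma smooth_map_Pair:
  assumes f: "smooth_map A B f" and h: "smooth_map A C h"
    and A: "\<And>U x. (U, x) \<in> A \<Longrightarrow> inj_on x U"
  shows "smooth_map A (prod_atlas B C) (\<lambda>p. (f p, h p))"
proof -
  have loc: "open (x ` (U \<inter> (\<lambda>p. (f p, h p)) -` W)) \<and>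
      smooth_on (x ` (U \<inter> (\<lambda>p. (f p, h p)) -` W)) (z \<circ> (\<lambda>p. (f p, h p)) \<circ> inv_into U x)"
    if U: "(U, x) \<in> A" and "(W, z) \<in> prod_atlas B C" for U x W z
  proof -
    obtain V y V' y' where W: "W = V \<times> V'" "z = map_prod y y'" and V: "(V, y) \<in> B" "(V', y') \<in> C"
      using \<open>(W, z) \<in> _\<close> by (auto simp: prod_atlas_iff)
    let ?S = "x ` (U \<inter> f -` V)" and ?S' = "x ` (U \<inter> h -` V')"
    note S = smooth_mapD(2,3)[OF f U V(1)] and S' = smooth_mapD(2,3)[OF h U V(2)]
    \<comment> \<open>The image under \<open>x\<close> commutes with the intersection because
      \<open>x\<close> is injective on \<open>U\<close>.\<close>
    have eq: "x ` (U \<inter> (\<lambda>p. (f p, h p)) -` W) = ?S \<inter> ?S'"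
      unfolding W(1) using A[OF U] by (auto dest: inj_onD)
    have op: "open (?S \<inter> ?S')" using S(1) S'(1) by (rule open_Int)
    have "smooth_on (?S \<inter> ?S') (\<lambda>r. ((y \<circ> f \<circ> inv_into U x) r, (y' \<circ> h \<circ> inv_into U x) r))"
      using smooth_on_subset[OF S(2) Int_lower1] smooth_on_subset[OF S'(2) Int_lower2]
      by (rule smooth_on_Pair[OF op])
    moreover have "(\<lambda>r. ((y \<circ> f \<circ> inv_into U x) r, (y' \<circ> h \<circ> inv_into U x) r)) =
        z \<circ> (\<lambda>p. (f p, h p)) \<circ> inv_into U x"
      by (auto simp: W(2))
    ultimately show ?thesis using op unfolding eq by simp
  qed
  show ?thesis
    by (rule smooth_mapI) (use loc smooth_mapD(1)[OF f] smooth_mapD(1)[OF h] in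
        \<open>auto simp: points_prod_atlas\<close>)
qed

section \<open>Tangent maps\<close>

lemma tangent_map_at_chart:
  assumes "chart_at A p = (U, x)" and "(V, y) \<in> B" and "f p \<in> V"
  shows "tangent_map A B f p v (V, y) =
    frechet_derivative (y \<circ> f \<circ> inv_into U x) (at (x p)) (v (U, x))"
  using assms by (simp add: tangent_map_def)

text \<open>The default value reduces equations between tangent vectors to the charts around the
  image point.\<close>

lemma tangent_map_eq_0: "\<not> (c \<in> B \<and> f p \<in> fst c) \<Longrightarrow> tangent_map A B f p v c = 0"
  by (auto simp: tangent_map_def split: prod.splits)

lemma smooth_map_has_derivative:
  assumes "smooth_map A B f" and "(U, x) \<in> A" and "p \<in> U" and "(V, y) \<in> B" and "f p \<in> V"
  shows "(y \<circ> f \<circ> inv_into U x has_derivative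
    frechet_derivative (y \<circ> f \<circ> inv_into U x) (at (x p))) (at (x p))"
proof -
  have "x p \<in> x ` (U \<inter> f -` V)" using assms(3,5) by blast
  from smooth_on_imp_differentiable[OF smooth_mapD(3)[OF assms(1,2,4)] this]
  show ?thesis by (simp add: frechet_derivative_works)
qed

text \<open>Each entry is a linear derivative applied to the single entry of the vector at
  \<open>chart_at A p\<close>.\<close>

lemma tangent_map_add:
  fixes B :: "('b, 'f::real_normed_vector) chart set"
  assumes f: "smooth_map A B f" and p: "p \<in> points A"
  shows "tangent_map A B f p (\<lambda>c. v c + w c) =
    (\<lambda>c. tangent_map A B f p v c + tangent_map A B f p w c)"
proof
  fix c :: "('b, 'f) chart"
  obtain V y where c: "c = (V, y)" by fastforce
  obtain U x where U: "chart_at A p = (U, x)" "(U, x) \<in> A" "p \<in> U"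
    using p by (rule chart_at_cases)
  show "tangent_map A B f p (\<lambda>c. v c + w c) c = tangent_map A B f p v c + tangent_map A B f p w c"
  proof (cases "c \<in> B \<and> f p \<in> fst c")
    case True
    then have V: "(V, y) \<in> B" "f p \<in> V" by (auto simp: c)
    show ?thesis
      using has_derivative_linear[OF smooth_map_has_derivative[OF f U(2,3) V]]
      by (simp add: c tangent_map_at_chart[where f = f, OF U(1) V] linear_add)
  qed (simp add: tangent_map_eq_0)
qed

text \<open>The outer tangent map reads its argument at \<open>chart_at B (f p)\<close>. Taking this
  same chart in the middle turns the claim into the chain rule for coordinate expressions, with no
  change of chart in between.\<close>

lemma tangent_map_compose:
  fixes C :: "('c, 'f::real_normed_vector) chart set"
  assumes f: "smooth_map A B f" and h: "smooth_map B C h"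
    and A: "\<And>U x. (U, x) \<in> A \<Longrightarrow> inj_on x U" and B: "\<And>V y. (V, y) \<in> B \<Longrightarrow> inj_on y V"
    and p: "p \<in> points A"
  shows "tangent_map B C h (f p) (tangent_map A B f p v) = tangent_map A C (\<lambda>s. h (f s)) p v"
proof
  fix c :: "('c, 'f) chart"
  obtain W z where c: "c = (W, z)" by fastforce
  obtain U x where U: "chart_at A p = (U, x)" "(U, x) \<in> A" "p \<in> U"
    using p by (rule chart_at_cases)
  obtain V y where V: "chart_at B (f p) = (V, y)" "(V, y) \<in> B" "f p \<in> V"
    using smooth_mapD(1)[OF f p] by (rule chart_at_cases)
  show "tangent_map B C h (f p) (tangent_map A B f p v) c = tangent_map A C (\<lambda>s. h (f s)) p v c"
  proof (cases "c \<in> C \<and> h (f p) \<in> fst c")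
    case True
    then have W: "(W, z) \<in> C" "h (f p) \<in> W" by (auto simp: c)
    let ?F = "y \<circ> f \<circ> inv_into U x" and ?H = "z \<circ> h \<circ> inv_into V y"
    let ?DF = "frechet_derivative ?F (at (x p))" and ?DH = "frechet_derivative ?H (at (y (f p)))"
    have F: "?F (x s) = y (f s)" if "s \<in> U" for s
      using inv_into_f_f[OF A[OF U(2)] that] by simp
    have "(?H has_derivative ?DH) (at (?F (x p)))"
      unfolding F[OF U(3)] by (rule smooth_map_has_derivative[OF h V(2,3) W])
    with smooth_map_has_derivative[OF f U(2,3) V(2,3)]
    have "((\<lambda>r. ?H (?F r)) has_derivative (\<lambda>u. ?DH (?DF u))) (at (x p))"
      by (rule has_derivative_compose)
    then have "(z \<circ> (\<lambda>s. h (f s)) \<circ> inv_into U x has_derivative (\<lambda>u. ?DH (?DF u))) (at (x p))"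
    proof (rule has_derivative_transform_within_open[OF _ smooth_mapD(2)[OF f U(2) V(2)]])
      show "x p \<in> x ` (U \<inter> f -` V)" using U(3) V(3) by blast
      fix r assume "r \<in> x ` (U \<inter> f -` V)"
      then obtain s where s: "s \<in> U" "f s \<in> V" "r = x s" by blast
      then show "?H (?F r) = (z \<circ> (\<lambda>s. h (f s)) \<circ> inv_into U x) r"
        using inv_into_f_f[OF A[OF U(2)] s(1)] inv_into_f_f[OF B[OF V(2)] s(2)] by simp
    qed
    from frechet_derivative_at[OF this] show ?thesis
      unfolding c tangent_map_at_chart[where f = h, OF V(1) W] tangent_map_at_chart[where f = f, OF U(1) V(2,3)]
        tangent_map_at_chart[where f = "\<lambda>s. h (f s)", OF U(1) W]
      by (rule fun_cong)
  qed (simp add: tangent_map_eq_0[of _ _ h] tangent_map_eq_0[of _ _ "\<lambda>s. h (f s)"])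
qed

text \<open>The product rule: in coordinates the derivative of \<open>F\<close> is linear on pairs,
  and a pair of velocities is the sum of its two axis components. A zero component corresponds to
  freezing that argument at \<open>p\<close>.\<close>

lemma tangent_map_binary:
  fixes D :: "('d, 'h::real_normed_vector) chart set"
  assumes f: "smooth_map A B f" and h: "smooth_map A C h"
    and F: "smooth_map (prod_atlas B C) D (\<lambda>(b, c). F b c)"
    and A: "\<And>U x. (U, x) \<in> A \<Longrightarrow> inj_on x U" and B: "\<And>V y. (V, y) \<in> B \<Longrightarrow> inj_on y V"
    and C: "\<And>V y. (V, y) \<in> C \<Longrightarrow> inj_on y V"
    and p: "p \<in> points A"
  shows "tangent_map A D (\<lambda>s. F (f s) (h s)) p v =
    (\<lambda>e. tangent_map A D (\<lambda>s. F (f s) (h p)) p v e + tangent_map A D (\<lambda>s. F (f p) (h s)) p v e)"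
proof
  fix e :: "('d, 'h) chart"
  obtain W z where e: "e = (W, z)" by fastforce
  obtain U x where U: "chart_at A p = (U, x)" "(U, x) \<in> A" "p \<in> U"
    using p by (rule chart_at_cases)
  obtain V y where V: "(V, y) \<in> B" "f p \<in> V"
    using smooth_mapD(1)[OF f p] by (auto simp: points_iff)
  obtain V' y' where V': "(V', y') \<in> C" "h p \<in> V'"
    using smooth_mapD(1)[OF h p] by (auto simp: points_iff)
  show "tangent_map A D (\<lambda>s. F (f s) (h s)) p v e =
    tangent_map A D (\<lambda>s. F (f s) (h p)) p v e + tangent_map A D (\<lambda>s. F (f p) (h s)) p v e"
  \<comment> \<open>All three maps take the same value at \<open>p\<close>, so their tangent maps
    vanish on the same charts.\<close>
  proof (cases "e \<in> D \<and> F (f p) (h p) \<in> fst e")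
    case True
    then have W: "(W, z) \<in> D" "F (f p) (h p) \<in> W" by (auto simp: e)
    let ?K = "z \<circ> (\<lambda>(b, c). F b c) \<circ> inv_into (V \<times> V') (map_prod y y')"
    let ?f = "y \<circ> f \<circ> inv_into U x" and ?h = "y' \<circ> h \<circ> inv_into U x"
    let ?Df = "frechet_derivative ?f (at (x p))" and ?Dh = "frechet_derivative ?h (at (x p))"
    let ?DK = "frechet_derivative ?K (at (map_prod y y' (f p, h p)))"
    have VV: "(V \<times> V', map_prod y y') \<in> prod_atlas B C" "(f p, h p) \<in> V \<times> V'"
      using V V' by (auto simp: prod_atlas_iff)
    have K: "?K (y b, y' c) = z (F b c)" if "b \<in> V" "c \<in> V'" for b c
      using inv_into_f_f[OF inj_on_prod_chart[OF B C VV(1)], of "(b, c)"] that by simp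
    have inv: "inv_into U x (x s) = s" if "s \<in> U" for s
      using inv_into_f_f[OF A[OF U(2)] that] .
    have DK: "(?K has_derivative ?DK) (at (y (f p), y' (h p)))"
      using smooth_map_has_derivative[OF F VV W(1)] W(2) by simp
    let ?S = "x ` (U \<inter> f -` V)" and ?S' = "x ` (U \<inter> h -` V')"
    have S: "open (?S \<inter> ?S')" "x p \<in> ?S \<inter> ?S'"
      using smooth_mapD(2)[OF f U(2) V(1)] smooth_mapD(2)[OF h U(2) V'(1)] U(3) V(2) V'(2) by auto
    \<comment> \<open>One computation for all three maps: \<open>a\<close> and \<open>b\<close> are
      to be the coordinate expressions of \<open>f\<close> and \<open>h\<close>, or constants with
      derivative 0.\<close>
    have *: "frechet_derivative (z \<circ> k \<circ> inv_into U x) (at (x p)) u = ?DK (Da u, Db u)"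
      if a: "(a has_derivative Da) (at (x p))" "a (x p) = y (f p)"
        and b: "(b has_derivative Db) (at (x p))" "b (x p) = y' (h p)"
        and k: "\<And>s. s \<in> U \<Longrightarrow> f s \<in> V \<Longrightarrow> h s \<in> V' \<Longrightarrow> ?K (a (x s), b (x s)) = z (k s)"
      for a Da b Db k u
    proof -
      have "((\<lambda>r. ?K (a r, b r)) has_derivative (\<lambda>u. ?DK (Da u, Db u))) (at (x p))"
        by (rule has_derivative_compose[OF has_derivative_Pair[OF a(1) b(1)]])
          (simp only: a(2) b(2) DK)
      then have "(z \<circ> k \<circ> inv_into U x has_derivative (\<lambda>u. ?DK (Da u, Db u))) (at (x p))"
      proof (rule has_derivative_transform_within_open[OF _ S])
        fix r assume r: "r \<in> ?S \<inter> ?S'"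
        then obtain s where s: "s \<in> U" "f s \<in> V" "r = x s" by blast
        from r obtain s' where s': "s' \<in> U" "h s' \<in> V'" "r = x s'" by blast
        have "s' = s" using inv[OF s(1)] inv[OF s'(1)] s(3) s'(3) by simp
        with k[OF s(1,2)] s' s(3) inv[OF s(1)] show "?K (a r, b r) = (z \<circ> k \<circ> inv_into U x) r"
          by simp
      qed
      from fun_cong[OF frechet_derivative_at[OF this]] show ?thesis by (rule sym)
    qed
    note Df = smooth_map_has_derivative[OF f U(2,3) V] and Dh = smooth_map_has_derivative[OF h U(2,3) V']
    have f': "?f (x s) = y (f s)" and h': "?h (x s) = y' (h s)" if "s \<in> U" for s
      using inv[OF that] by simp_all
    note p' = f'[OF U(3)] h'[OF U(3)]
    let ?v = "v (U, x)"
    have "frechet_derivative (z \<circ> (\<lambda>s. F (f s) (h s)) \<circ> inv_into U x) (at (x p)) ?v = ?DK (?Df ?v, ?Dh ?v)"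
      by (rule *[OF Df p'(1) Dh p'(2)]) (simp only: f' h' K)
    moreover have "frechet_derivative (z \<circ> (\<lambda>s. F (f s) (h p)) \<circ> inv_into U x) (at (x p)) ?v = ?DK (?Df ?v, 0)"
      by (rule *[OF Df p'(1) has_derivative_const refl]) (simp only: f' K V'(2))
    moreover have "frechet_derivative (z \<circ> (\<lambda>s. F (f p) (h s)) \<circ> inv_into U x) (at (x p)) ?v = ?DK (0, ?Dh ?v)"
      by (rule *[OF has_derivative_const refl Dh p'(2)]) (simp only: h' K V(2))
    moreover have "?DK (?Df ?v, ?Dh ?v) = ?DK (?Df ?v, 0) + ?DK (0, ?Dh ?v)"
      using linear_add[OF has_derivative_linear[OF DK], of "(?Df ?v, 0)" "(0, ?Dh ?v)"] by simp
    ultimately show ?thesis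
      using tangent_map_at_chart[where f = "\<lambda>s. F (f s) (h s)", OF U(1) W]
        tangent_map_at_chart[where f = "\<lambda>s. F (f s) (h p)", OF U(1) W]
        tangent_map_at_chart[where f = "\<lambda>s. F (f p) (h s)", OF U(1) W]
      by (simp only: e)
  qed (simp add: tangent_map_eq_0[of _ _ "\<lambda>s. F (f s) (h s)"]
      tangent_map_eq_0[of _ _ "\<lambda>s. F (f s) (h p)"] tangent_map_eq_0[of _ _ "\<lambda>s. F (f p) (h s)"])
qed

section \<open>Reconstruction\<close>

lemma smooth_manifoldD:
  fixes A :: "('a, 'e::real_normed_vector) chart set"
  assumes "smooth_manifold A"
  shows "\<exists>S::'e set. finite S \<and> span S = UNIV" and "smooth_atlas A"
    and "(U, x) \<in> A \<Longrightarrow> inj_on x U" and "(U, x) \<in> A \<Longrightarrow> open (x ` U)"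
  using assms unfolding smooth_manifold_def smooth_atlas_def by blast+

text \<open>The map factors through the pairing into the product. With a constant or identity map in
  either slot, this also yields orbit maps and translations.\<close>

lemma smooth_map_binary:
  fixes B :: "('b, 'e::real_normed_vector) chart set" and C :: "('c, 'f::real_normed_vector) chart set"
  assumes B: "smooth_manifold B" and C: "smooth_manifold C"
    and F: "smooth_map (prod_atlas B C) D (\<lambda>(b, c). F b c)"
    and f: "smooth_map A B f" and h: "smooth_map A C h"
    and A: "\<And>U x. (U, x) \<in> A \<Longrightarrow> inj_on x U"
  shows "smooth_map A D (\<lambda>s. F (f s) (h s))"
proof -
  have "smooth_map A D ((\<lambda>(b, c). F b c) \<circ> (\<lambda>s. (f s, h s)))"
    using smooth_map_Pair[OF f h A] F A
      inj_on_prod_chart[OF smooth_manifoldD(3)[OF B] smooth_manifoldD(3)[OF C]]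
      finite_dimensional_prod[OF smooth_manifoldD(1)[OF B] smooth_manifoldD(1)[OF C]]
    by (rule smooth_map_compose)
  then show ?thesis by (simp add: comp_def)
qed

theorem proposition6p2:
  fixes G :: "('g, 'r) monoid_scheme"
    and AG :: "('g, 'eg::real_normed_vector) chart set"
    and AM :: "('m, 'em::real_normed_vector) chart set"
    and AQ :: "('m set, 'eq::real_normed_vector) chart set"
    and act :: "'g \<Rightarrow> 'm \<Rightarrow> 'm"
    and \<gamma> :: "'m \<Rightarrow> ('k::finite \<Rightarrow> ('m set, 'eq) tvec) \<Rightarrow> 'k \<Rightarrow> ('m, 'em) tvec"
    and \<theta> :: "'m \<Rightarrow> ('k \<Rightarrow> ('m, 'em) tvec) \<Rightarrow> 'k \<Rightarrow> ('g, 'eg) tvec"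
    and X :: "'m \<Rightarrow> 'k \<Rightarrow> ('m, 'em) tvec"
    and X\<^sub>r :: "'m set \<Rightarrow> 'k \<Rightarrow> ('m set, 'eq) tvec"
    and \<phi>\<^sub>r :: "real ^ 'k \<Rightarrow> 'm set"
    and \<phi>\<^sub>H :: "real ^ 'k \<Rightarrow> 'm"
    and g :: "real ^ 'k \<Rightarrow> 'g"
  assumes "lie_group G AG" and "connected_space (atlas_topology AG)"
    and "smooth_manifold AM"
    and "smooth_action G AG AM act"
    and "free_action G (points AM) act" and "proper_action AG AM act"
    and "principal_bundle G AG AM act AQ"
    and "principal_k_connection G AM act AQ \<gamma>"
    and "connection_form G AG AM act AQ \<gamma> \<theta>"
    and "k_vector_field AM X" and "integrable_k_vector_field AM X"
    and "invariant_k_vector_field G AM act X"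
    and "reduced_k_vector_field G AM act AQ X X\<^sub>r" and "integrable_k_vector_field AQ X\<^sub>r"
    and "integrable_k_vector_field AM (horizontal_lift_field G act \<gamma> X\<^sub>r)"
    and "integral_section AQ X\<^sub>r \<phi>\<^sub>r"
    and "horizontal_lift_section G AM act \<gamma> X\<^sub>r \<phi>\<^sub>r \<phi>\<^sub>H"
    and "smooth_map (euclidean_atlas UNIV) AG g"
    and "\<And>t. left_log_derivative G AG g t = \<theta> (\<phi>\<^sub>H t) (X (\<phi>\<^sub>H t))"
  shows "integral_section AM X (\<lambda>t. act (g t) (\<phi>\<^sub>H t))"
proof -
  let ?E = "euclidean_atlas (UNIV :: (real ^ 'k) set)"
  interpret group G using assms(1) by (simp add: lie_group_def)
  interpret group_action G "points AM" act using assms(4) by (simp add: smooth_action_def)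
  have AG: "smooth_manifold AG" "points AG = carrier G"
    and mult: "smooth_map (prod_atlas AG AG) AG (\<lambda>(g, h). g \<otimes>\<^bsub>G\<^esub> h)"
    using assms(1) by (simp_all add: lie_group_def)
  note AM = \<open>smooth_manifold AM\<close>
  have act: "smooth_map (prod_atlas AG AM) AM (\<lambda>(g, m). act g m)"
    using assms(4) by (simp add: smooth_action_def)
  note injG = smooth_manifoldD(3)[OF AG(1)] and injM = smooth_manifoldD(3)[OF AM]
  have injE: "inj_on x U" if "(U, x) \<in> ?E" for U x
    using that by (simp add: euclidean_atlas_def)
  have ptsE: "t \<in> points ?E" for t by (simp add: points_def euclidean_atlas_def)
  note g = \<open>smooth_map ?E AG g\<close>
  have phiH: "smooth_map ?E AM \<phi>\<^sub>H"
    and lift: "prolongation UNIV AM \<phi>\<^sub>H t = \<gamma> (\<phi>\<^sub>H t) (X\<^sub>r (orbit G act (\<phi>\<^sub>H t)))" for t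
    using assms(17)
    by (simp_all add: horizontal_lift_section_def integral_section_on_def horizontal_lift_field_def)
  have smooth_orbit_map: "smooth_map AG AM (\<lambda>h. act h m)" if "m \<in> points AM" for m
    by (rule smooth_map_binary[OF AG(1) AM act smooth_map_ident[OF smooth_manifoldD(2)[OF AG(1)]]
          smooth_map_const[OF smooth_manifoldD(4)[OF AG(1)] that] injG])
  have smooth_act: "smooth_map AM AM (act a)" if "a \<in> carrier G" for a
    using smooth_map_binary[OF AG(1) AM act smooth_map_const[OF smooth_manifoldD(4)[OF AM]]
        smooth_map_ident[OF smooth_manifoldD(2)[OF AM]] injM] that AG(2) by simp
  have smooth_mult: "smooth_map AG AG (\<lambda>h. a \<otimes>\<^bsub>G\<^esub> h)" if "a \<in> carrier G" for a
    using smooth_map_binary[OF AG(1) AG(1) mult smooth_map_const[OF smooth_manifoldD(4)[OF AG(1)]]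
        smooth_map_ident[OF smooth_manifoldD(2)[OF AG(1)]] injG] that AG(2) by simp
  have gt: "g t \<in> carrier G" for t
    using smooth_mapD(1)[OF g ptsE] AG(2) by simp
  have phiHt: "\<phi>\<^sub>H t \<in> points AM" for t
    using phiH ptsE by (rule smooth_mapD(1))
  have "prolongation UNIV AM (\<lambda>s. act (g s) (\<phi>\<^sub>H s)) t \<alpha> = X (act (g t) (\<phi>\<^sub>H t)) \<alpha>" for t \<alpha>
  proof -
    let ?m = "\<phi>\<^sub>H t" and ?d = "coord_vec UNIV \<alpha>"
    let ?Tg = "tangent_map ?E AG g t ?d" and ?Th = "tangent_map ?E AM \<phi>\<^sub>H t ?d"
    let ?\<xi> = "left_log_derivative G AG g t \<alpha>"
    have Xm: "X ?m \<in> k_tangent_space AM ?m"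
      using assms(10) phiHt by (simp add: k_vector_field_def)
    have red: "k_tangent_map AM AQ (orbit G act) ?m (X ?m) = X\<^sub>r (orbit G act ?m)"
      using assms(13) phiHt by (simp add: reduced_k_vector_field_def)
    \<comment> \<open>The reconstruction equation replaces the value of \<open>\<theta>\<close> by
      \<open>?\<xi>\<close>.\<close>
    have vert: "vertical_projection G AM act AQ \<gamma> ?m (X ?m) \<alpha> = fundamental_field G AG AM act ?\<xi> ?m"
      using assms(9,19) phiHt Xm by (simp add: connection_form_def)
    \<comment> \<open>Since \<open>\<phi>\<^sub>H\<close> is an integral section of the horizontal
      lift and \<open>X ?m\<close> projects to the reduced field, \<open>?Th\<close> is precisely
      the term that \<open>vertical_projection\<close> subtracts.\<close>
    have split: "X ?m \<alpha> = (\<lambda>c. fundamental_field G AG AM act ?\<xi> ?m c + ?Th c)"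
    proof
      fix c
      have "?Th c = \<gamma> ?m (X\<^sub>r (orbit G act ?m)) \<alpha> c"
        using fun_cong[OF fun_cong[OF lift[of t]], of \<alpha> c]
        by (simp add: prolongation_def k_tangent_map_def)
      moreover have "fundamental_field G AG AM act ?\<xi> ?m c =
          X ?m \<alpha> c - \<gamma> ?m (X\<^sub>r (orbit G act ?m)) \<alpha> c"
        using fun_cong[OF vert, of c] by (simp add: vertical_projection_def red)
      ultimately show "X ?m \<alpha> c = fundamental_field G AG AM act ?\<xi> ?m c + ?Th c" by simp
    qed
    have \<xi>: "?\<xi> = tangent_map AG AG (\<lambda>h. inv\<^bsub>G\<^esub> (g t) \<otimes>\<^bsub>G\<^esub> h) (g t) ?Tg"
      by (simp add: left_log_derivative_def k_tangent_map_def prolongation_def)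
    have "?\<xi> = tangent_map ?E AG (\<lambda>s. inv\<^bsub>G\<^esub> (g t) \<otimes>\<^bsub>G\<^esub> g s) t ?d"
      unfolding \<xi> by (rule tangent_map_compose[OF g smooth_mult[OF inv_closed[OF gt]] injE injG ptsE])
    moreover have translate: "smooth_map ?E AG (\<lambda>s. inv\<^bsub>G\<^esub> (g t) \<otimes>\<^bsub>G\<^esub> g s)"
      using smooth_map_compose[OF g smooth_mult[OF inv_closed[OF gt]] injE injG
          smooth_manifoldD(1)[OF AG(1)]] by (simp add: comp_def)
    \<comment> \<open>The chain rule places the tangent map of the orbit map at the product of
      \<open>inv (g t)\<close> and \<open>g t\<close>, which is the unit at which
      \<open>fundamental_field\<close> differentiates.\<close>
    ultimately have fund: "fundamental_field G AG AM act ?\<xi> ?m =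
        tangent_map ?E AM (\<lambda>s. act (inv\<^bsub>G\<^esub> (g t) \<otimes>\<^bsub>G\<^esub> g s) ?m) t ?d"
      using tangent_map_compose[OF translate smooth_orbit_map[OF phiHt] injE injG ptsE, of t t ?d] gt
      by (simp add: fundamental_field_def)
    have moved: "smooth_map ?E AM (\<lambda>s. act (inv\<^bsub>G\<^esub> (g t) \<otimes>\<^bsub>G\<^esub> g s) ?m)"
      using smooth_map_compose[OF translate smooth_orbit_map[OF phiHt] injE injG
          smooth_manifoldD(1)[OF AG(1)]] by (simp add: comp_def)
    have cancel: "act (g t) (act (inv\<^bsub>G\<^esub> (g t) \<otimes>\<^bsub>G\<^esub> g s) ?m) = act (g s) ?m" for s
    proof -
      have "act (g t) (act (inv\<^bsub>G\<^esub> (g t) \<otimes>\<^bsub>G\<^esub> g s) ?m) =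
          act (g t \<otimes>\<^bsub>G\<^esub> (inv\<^bsub>G\<^esub> (g t) \<otimes>\<^bsub>G\<^esub> g s)) ?m"
        using composition_rule[OF phiHt gt, of "inv\<^bsub>G\<^esub> (g t) \<otimes>\<^bsub>G\<^esub> g s"] gt by simp
      also have "g t \<otimes>\<^bsub>G\<^esub> (inv\<^bsub>G\<^esub> (g t) \<otimes>\<^bsub>G\<^esub> g s) = g s"
        using gt by (simp flip: m_assoc)
      finally show ?thesis .
    qed
    \<comment> \<open>The base point at which the next chain rule evaluates the tangent map of
      \<open>act (g t)\<close>.\<close>
    have pt: "act (inv\<^bsub>G\<^esub> (g t) \<otimes>\<^bsub>G\<^esub> g t) ?m = ?m"
      using gt id_eq_one[symmetric] phiHt by simp
    have vert': "tangent_map AM AM (act (g t)) ?m (fundamental_field G AG AM act ?\<xi> ?m) =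
        tangent_map ?E AM (\<lambda>s. act (g s) ?m) t ?d"
      using tangent_map_compose[OF moved smooth_act[OF gt] injE injM ptsE, of t t ?d]
      by (simp only: fund pt cancel)
    have hor': "tangent_map AM AM (act (g t)) ?m ?Th = tangent_map ?E AM (\<lambda>s. act (g t) (\<phi>\<^sub>H s)) t ?d"
      by (rule tangent_map_compose[OF phiH smooth_act[OF gt] injE injM ptsE])
    have "X (act (g t) ?m) \<alpha> = tangent_map AM AM (act (g t)) ?m (X ?m \<alpha>)"
      using assms(12) gt phiHt by (simp add: invariant_k_vector_field_def k_tangent_map_def)
    \<comment> \<open>Additivity separates the translated vector into the derivatives with
      \<open>\<phi>\<^sub>H\<close> frozen and with \<open>g\<close> frozen, the two terms of the
      product rule.\<close>
    also have "\<dots> = tangent_map ?E AM (\<lambda>s. act (g s) (\<phi>\<^sub>H s)) t ?d"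
      unfolding split tangent_map_add[OF smooth_act[OF gt] phiHt] vert' hor'
      by (rule tangent_map_binary[OF g phiH act injE injG injM ptsE, symmetric])
    finally show ?thesis by (simp add: prolongation_def k_tangent_map_def)
  qed
  moreover have "smooth_map ?E AM (\<lambda>s. act (g s) (\<phi>\<^sub>H s))"
    by (rule smooth_map_binary[OF AG(1) AM act g phiH injE])
  ultimately show ?thesis by (auto simp: integral_section_on_def)
qed

end
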